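(* Let $(X,F)$ be a CR-dynamical system. If $(X_F^+,\sigma_F^+)$ is transitive, then $(X,F)$ is $\sigma$-transitive.
   Context: A closed relation on a non-empty compact metric space $X$ is a closed subset $F\subseteq X\times X$; if $X$ is a compact metric space and $F$ is a closed relation on $X$, the pair $(X,F)$ is called a CR-dynamical system (a dynamical system with a closed relation). The Mahavier product of $F$ is $X_F^+=\{(x_1,x_2,x_3,\ldots)\in\prod_{i=1}^\infty X : (x_i,x_{i+1})\in F\text{ for each positive integer } i\}$ with the subspace topology, and the shift map $\sigma_F^+:X_F^+\to X_F^+$ is $\sigma_F^+(x_1,x_2,x_3,\ldots)=(x_2,x_3,x_4,\ldots)$. For $\mathbf x=(x_1,x_2,\ldots)$, $\pi_k(\mathbf x)=x_k$. $(X,F)$ is $\sigma$-transitive if there is a countable collection $\mathcal U=\{U_1,U_2,U_3,\ldots\}$ of open sets in $\prod_{i=1}^\infty X$ such that (1) for each positive integer $j$ there are a positive integer $m_j$ and open sets $U_1^j,\ldots,U_{m_j}^j$ in $X$ with $U_j=U_1^j\times\cdots\times U_{m_j}^j\times\prod_{i=m_j+1}^\infty X$; (2) for each open set $V$ in $\prod_{i=1}^\infty X$ with $V\cap X_F^+\neq\emptyset$ and each $\mathbf t\in V\cap X_F^+$ there is a positive integer $j$ with $\mathbf t\in U_j\subseteq V$; (3) there is a sequence $(\mathbf x_j)$ of points in $X_F^+$ such that for each positive integer $j$, $\mathbf x_j\in U_j$ and there is a positive integer $\ell_j>m_j$ with $\pi_{\ell_j}(\mathbf x_j)=\pi_1(\mathbf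 x_{j+1})$. A dynamical system $(Y,f)$ is transitive if for all non-empty open sets $U,V$ in $Y$ there is a non-negative integer $n$ with $f^n(U)\cap V\neq\emptyset$.
   Formalization: The Mahavier product X_F^+ is additionally assumed non-empty; if it is empty (e.g. F empty), transitivity holds vacuously while σ-transitivity fails, since condition (3) requires points of X_F^+. *)

theory Defs
  imports "HOL-Analysis.Analysis"
begin

definition CR_dynamical_system :: "'a::metric_space set \<Rightarrow> ('a \<times> 'a) set \<Rightarrow> bool" where
  "CR_dynamical_system X F \<longleftrightarrow>
     X \<noteq> {} \<and> compact X \<and> closedin (prod_topology (top_of_set X) (top_of_set X)) F"

definition seq_space :: "'a::metric_space set \<Rightarrow> (nat \<Rightarrow> 'a) topology" where
  "seq_space X = product_topology (\<lambda>_. top_of_set X) UNIV"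

text \<open>A sequence (x_1, x_2, ...) is a function on \<open>nat\<close>, its value at \<open>i\<close> being x_(i+1).
  The projections keep the index base 1; only their values at \<open>k \<ge> 1\<close> are meaningful.\<close>

definition coord :: "nat \<Rightarrow> (nat \<Rightarrow> 'a) \<Rightarrow> 'a" where
  "coord k x = x (k - 1)"

definition mahavier_product :: "'a::metric_space set \<Rightarrow> ('a \<times> 'a) set \<Rightarrow> (nat \<Rightarrow> 'a) set" where
  "mahavier_product X F = {x \<in> topspace (seq_space X). \<forall>i. (x i, x (Suc i)) \<in> F}"

definition mahavier_space :: "'a::metric_space set \<Rightarrow> ('a \<times> 'a) set \<Rightarrow> (nat \<Rightarrow> 'a) topology" where
  "mahavier_space X F = subtopology (seq_space X) (mahavier_product X F)"

definition shift_map :: "(nat \<Rightarrow> 'a) \<Rightarrow> (nat \<Rightarrow> 'a)" where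
  "shift_map x = (\<lambda>i. x (Suc i))"

text \<open>Dynamical systems live on non-empty spaces, whereas the condition below is vacuous on an empty
  one.  The Mahavier product can be empty (e.g. for \<open>F = {}\<close>), so its non-emptiness has to be
  assumed along with transitivity.\<close>

definition transitive_system :: "'b topology \<Rightarrow> ('b \<Rightarrow> 'b) \<Rightarrow> bool" where
  "transitive_system Y f \<longleftrightarrow>
     (\<forall>U V. openin Y U \<and> U \<noteq> {} \<and> openin Y V \<and> V \<noteq> {} \<longrightarrow>
        (\<exists>n::nat. (f ^^ n) ` U \<inter> V \<noteq> {}))"

text \<open>The collection is given by an enumeration \<open>U\<close>, in which repetitions are allowed: if \<open>X\<close> is a
  single point, the whole product is the only non-empty open set.  The numbers \<open>m j\<close> are those of
  the chosen representation of \<open>U j\<close> as a box with sides \<open>W j 0, ..., W j (m j - 1), X, X, ...\<close>;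
  the last condition refers to the same \<open>m j\<close>.\<close>

definition sigma_transitive :: "'a::metric_space set \<Rightarrow> ('a \<times> 'a) set \<Rightarrow> bool" where
  "sigma_transitive X F \<longleftrightarrow>
     (\<exists>(U :: nat \<Rightarrow> (nat \<Rightarrow> 'a) set) (m :: nat \<Rightarrow> nat) (W :: nat \<Rightarrow> nat \<Rightarrow> 'a set).
        (\<forall>j. openin (seq_space X) (U j)) \<and>
        (\<forall>j. 0 < m j \<and> (\<forall>i < m j. openin (top_of_set X) (W j i)) \<and>
             U j = (\<Pi>\<^sub>E i\<in>UNIV. if i < m j then W j i else X)) \<and>
        (\<forall>V. openin (seq_space X) V \<and> V \<inter> mahavier_product X F \<noteq> {} \<longrightarrow>
             (\<forall>t \<in> V \<inter> mahavier_product X F. \<exists>j. t \<in> U j \<and> U j \<subseteq> V)) \<and>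
        (\<exists>x :: nat \<Rightarrow> (nat \<Rightarrow> 'a).
             (\<forall>j. x j \<in> mahavier_product X F) \<and>
             (\<forall>j. x j \<in> U j \<and> (\<exists>l > m j. coord l (x j) = coord 1 (x (Suc j))))))"

end

theory Submission
  imports Defs
begin

text \<open>If a continuous map on a Hausdorff space is transitive, then its image is dense: a non-empty
  open set missed by the image would meet every non-empty open set already at time 0, which forces
  the space to be a single fixed point.  Hence transitivity also holds with arbitrarily late
  times, and by the Baire category theorem some point \<open>z\<close> of the compact Mahavier product
  visits every member of a countable base of cylinders infinitely often.  Choosing visits to
  \<open>U_1, U_2, ...\<close> along this single orbit, with gaps \<open>n_(j+1) - n_j\<close> at least \<open>m_j\<close>, the points
  \<open>x_j\<close> obtained by shifting \<open>z\<close> by \<open>n_j\<close> satisfy the linking condition.\<close>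

section \<open>Transitive maps on abstract topological spaces\<close>

lemma continuous_map_funpow:
  assumes "continuous_map Y Y f"
  shows "continuous_map Y Y (f ^^ n)"
proof (induction n)
  case (Suc n)
  show ?case
    unfolding funpow.simps by (rule continuous_map_compose[OF Suc.IH assms])
qed (simp add: id_def)

lemma transitive_systemE:
  assumes "transitive_system Y f" "openin Y U" "U \<noteq> {}" "openin Y V" "V \<noteq> {}"
  obtains n u where "u \<in> U" "(f ^^ n) u \<in> V"
proof -
  have "\<exists>n. (f ^^ n) ` U \<inter> V \<noteq> {}"
    using assms(1)[unfolded transitive_system_def, THEN spec[of _ U], THEN spec[of _ V]] assms(2-)
    by blast
  then show thesis using that by blast
qed

lemma transitive_system_dense_image:
  assumes Y: "Hausdorff_space Y" and f: "continuous_map Y Y f" and tr: "transitive_system Y f"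
    and V: "openin Y V" "V \<noteq> {}"
  shows "\<exists>y \<in> topspace Y. f y \<in> V"
proof (rule ccontr)
  assume miss: "\<not> ?thesis"
  have fY: "f y \<in> topspace Y" if "y \<in> topspace Y" for y
    using f that by (auto simp: continuous_map_def)
  \<comment> \<open>A positive hitting time is excluded because the last iterate before
    \<open>B\<close> would be a point that \<open>f\<close> sends into \<open>V\<close>.\<close>
  have meet: "A \<inter> B \<noteq> {}" if A: "openin Y A" "A \<noteq> {}" and B: "openin Y B" "B \<noteq> {}" "B \<subseteq> V" for A B
  proof -
    obtain n a where a: "a \<in> A" "(f ^^ n) a \<in> B"
      by (rule transitive_systemE[OF tr A B(1,2)])
    have "n = 0"
    proof (rule ccontr)
      assume "n \<noteq> 0"
      then obtain k where k: "n = Suc k" using not0_implies_Suc by blast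
      have "a \<in> topspace Y" using A(1) a(1) openin_subset by blast
      then have "(f ^^ k) a \<in> topspace Y"
        using continuous_map_funpow[OF f, of k] by (auto simp: continuous_map_def)
      then show False
        using miss a(2) B(3) k by auto
    qed
    then show ?thesis using a by auto
  qed
  obtain p where p: "p \<in> V" using V(2) by blast
  then have pY: "p \<in> topspace Y" using V(1) openin_subset by blast
  \<comment> \<open>If \<open>p\<close> were fixed, \<open>p\<close> itself would be a point mapped
    into \<open>V\<close>.\<close>
  have "f p \<noteq> p" using miss p pY by metis
  then obtain A B where AB: "openin Y A" "openin Y B" "f p \<in> A" "p \<in> B" "disjnt A B"
    using Y pY fY unfolding Hausdorff_space_def by metis
  have "A \<inter> (B \<inter> V) \<noteq> {}"
    using AB V p by (intro meet) auto
  then show False using AB(5) by (auto simp: disjnt_def)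
qed

text \<open>Induction on \<open>N\<close> with the target varying: a visit to the preimage of
  \<open>V\<close> is a visit to \<open>V\<close> one step later, and density of the image keeps
  that preimage non-empty.\<close>

lemma transitive_system_hits_late:
  assumes Y: "Hausdorff_space Y" and f: "continuous_map Y Y f" and tr: "transitive_system Y f"
    and U: "openin Y U" "U \<noteq> {}" and V: "openin Y V" "V \<noteq> {}"
  shows "\<exists>n \<ge> N. \<exists>u \<in> U. (f ^^ n) u \<in> V"
proof -
  have "\<exists>n \<ge> N. \<exists>u \<in> U. (f ^^ n) u \<in> V" if "openin Y V" "V \<noteq> {}" for V
    using that
  proof (induction N arbitrary: V)
    case 0
    then obtain n u where "u \<in> U" "(f ^^ n) u \<in> V"
      by (rule transitive_systemE[OF tr U])
    then show ?case by (intro exI[of _ n]) auto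
  next
    case (Suc N)
    let ?P = "{y \<in> topspace Y. f y \<in> V}"
    have "openin Y ?P" "?P \<noteq> {}"
      using openin_continuous_map_preimage[OF f] transitive_system_dense_image[OF Y f tr] Suc.prems
      by auto
    from Suc.IH[OF this] obtain n u where "n \<ge> N" "u \<in> U" "(f ^^ n) u \<in> ?P" by blast
    then have "Suc n \<ge> Suc N" "(f ^^ Suc n) u \<in> V" by auto
    then show ?case using \<open>u \<in> U\<close> by blast
  qed
  then show ?thesis using V by blast
qed

text \<open>Visits at arbitrarily late times, rather than a mere dense orbit, allow the sets
  \<open>U j\<close> to be met in a prescribed order and with prescribed gaps.\<close>

lemma transitive_system_recurrent_point:
  assumes Y: "compact_space Y" "Hausdorff_space Y" "topspace Y \<noteq> {}"
    and f: "continuous_map Y Y f" and tr: "transitive_system Y f"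
    and U: "\<And>j::nat. openin Y (U j) \<and> U j \<noteq> {}"
  shows "\<exists>z \<in> topspace Y. \<forall>j N. \<exists>n \<ge> N. (f ^^ n) z \<in> U j"
proof -
  \<comment> \<open>Points that visit \<open>U j\<close> at time \<open>N\<close> or later. There
    are countably many such sets; continuity of the iterates makes them open, and late hits make
    them dense.\<close>
  define G where "G = (\<lambda>(j, N). \<Union>n \<in> {N..}. {y \<in> topspace Y. (f ^^ n) y \<in> U j})"
  have G: "openin Y (G p) \<and> Y closure_of (G p) = topspace Y" for p
  proof -
    obtain j N where p: "p = (j, N)" by fastforce
    have "openin Y (G p)"
      unfolding G_def p using U continuous_map_funpow[OF f]
      by (auto intro!: openin_continuous_map_preimage)
    moreover have "G p \<inter> T \<noteq> {}" if T: "openin Y T" "T \<noteq> {}" for T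
    proof -
      obtain n u where "n \<ge> N" "u \<in> T" "(f ^^ n) u \<in> U j"
        using transitive_system_hits_late[OF Y(2) f tr T, of "U j" N] U by blast
      then show ?thesis
        unfolding G_def p using openin_subset[OF T(1)] by auto
    qed
    ultimately show ?thesis
      by (auto simp: dense_intersects_open)
  qed
  have "Y closure_of \<Inter> (range G) = topspace Y"
    using G compact_Hausdorff_imp_regular_space[OF Y(1,2)] compact_imp_locally_compact_space[OF Y(1)]
    by (intro Baire_category) auto
  then have "\<Inter> (range G) \<noteq> {}"
    using Y(3) by force
  then obtain z where z: "\<And>j N. z \<in> G (j, N)" by blast
  show ?thesis
  proof (intro bexI allI)
    show "z \<in> topspace Y" using z[of 0 0] by (auto simp: G_def)
    show "\<exists>n \<ge> N. (f ^^ n) z \<in> U j" for j N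
      using z[of j N] by (auto simp: G_def)
  qed
qed

section \<open>Countable bases of compact metric sets\<close>

lemma second_countable_compact_metric:
  fixes X :: "'a::metric_space set"
  assumes "compact X"
  shows "second_countable (top_of_set X)"
proof -
  have "\<exists>k. finite k \<and> X \<subseteq> (\<Union>x\<in>k. ball x (1 / real (Suc n)))" for n
  proof -
    have "1 / real (Suc n) > 0" by simp
    with assms show ?thesis
      unfolding compact_eq_totally_bounded by blast
  qed
  then have "\<forall>n. \<exists>k. finite k \<and> X \<subseteq> (\<Union>x\<in>k. ball x (1 / real (Suc n)))"
    by (rule allI)
  from choice[OF this] obtain k where
    k: "\<And>n. finite (k n)" "\<And>n. X \<subseteq> (\<Union>x\<in>k n. ball x (1 / real (Suc n)))"
    by blast
  \<comment> \<open>Traces on \<open>X\<close> of the balls around finite nets of radius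
    \<open>1 / Suc n\<close>; the centres need not lie in \<open>X\<close>.\<close>
  let ?B = "\<Union>n. (\<lambda>x. X \<inter> ball x (1 / real (Suc n))) ` k n"
  have "\<exists>V \<in> ?B. x \<in> V \<and> V \<subseteq> U" if U: "openin (top_of_set X) U" and x: "x \<in> U" for U x
  proof -
    obtain e where e: "e > 0" "ball x e \<inter> X \<subseteq> U"
      using U x by (metis openin_contains_ball)
    \<comment> \<open>With a radius below \<open>e / 2\<close>, any net ball containing
      \<open>x\<close> lies inside \<open>ball x e\<close>.\<close>
    obtain n where n: "1 / real (Suc n) < e / 2"
      using e(1) by (meson half_gt_zero nat_approx_posE)
    have xX: "x \<in> X" using U x by (meson openin_imp_subset subsetD)
    then obtain c where c: "c \<in> k n" "x \<in> ball c (1 / real (Suc n))"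
      using k(2) by blast
    have "ball c (1 / real (Suc n)) \<subseteq> ball x e"
    proof
      fix y assume "y \<in> ball c (1 / real (Suc n))"
      then have "dist c y < e / 2" "dist c x < e / 2"
        using c(2) n by auto
      then show "y \<in> ball x e"
        using dist_triangle[of x y c] by (simp add: dist_commute)
    qed
    then have "X \<inter> ball c (1 / real (Suc n)) \<subseteq> U" using e(2) by blast
    then show ?thesis using c xX by blast
  qed
  moreover have "countable ?B"
    using k(1) by (auto intro: countable_finite)
  ultimately show ?thesis
    unfolding second_countable_def by (intro exI[of _ ?B]) auto
qed

section \<open>The Mahavier product as a compact Hausdorff system, and cylinders\<close>

lemma shift_map_funpow: "(shift_map ^^ n) x = (\<lambda>i. x (i + n))"
  by (induction n) (auto simp: shift_map_def)

lemma topspace_seq_space: "topspace (seq_space X) = {x. \<forall>i. x i \<in> X}"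
  by (auto simp: seq_space_def)

lemma topspace_mahavier_space: "topspace (mahavier_space X F) = mahavier_product X F"
  by (auto simp: mahavier_space_def mahavier_product_def)

text \<open>Each condition on two consecutive coordinates is the preimage of the closed set
  \<open>F\<close> under a continuous map.\<close>

lemma closedin_mahavier_product:
  assumes "closedin (prod_topology (top_of_set X) (top_of_set X)) F"
  shows "closedin (seq_space X) (mahavier_product X F)"
proof -
  have "continuous_map (seq_space X) (prod_topology (top_of_set X) (top_of_set X)) (\<lambda>x. (x i, x (Suc i)))" for i
    unfolding continuous_map_pairwise seq_space_def comp_def
    by (auto intro!: continuous_map_product_projection)
  then have "closedin (seq_space X) {x \<in> topspace (seq_space X). (x i, x (Suc i)) \<in> F}" for i
    using closedin_continuous_map_preimage assms by blast
  then have "closedin (seq_space X) (\<Inter>i. {x \<in> topspace (seq_space X). (x i, x (Suc i)) \<in> F})"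
    by (intro closedin_Inter) auto
  moreover have "mahavier_product X F = (\<Inter>i. {x \<in> topspace (seq_space X). (x i, x (Suc i)) \<in> F})"
    by (auto simp: mahavier_product_def)
  ultimately show ?thesis by simp
qed

lemma compact_space_mahavier_space:
  assumes "CR_dynamical_system X F"
  shows "compact_space (mahavier_space X F)"
proof -
  have "compact_space (seq_space X)"
    using assms unfolding seq_space_def CR_dynamical_system_def
    by (simp add: compact_space_product_topology compact_space_subtopology)
  then show ?thesis
    unfolding mahavier_space_def
    using closedin_mahavier_product assms closedin_compact_space compact_space_subtopology
    unfolding CR_dynamical_system_def by blast
qed

lemma Hausdorff_space_mahavier_space: "Hausdorff_space (mahavier_space X F)"
  unfolding mahavier_space_def seq_space_def
  by (simp add: Hausdorff_space_subtopology Hausdorff_space_product_topology)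

lemma continuous_map_shift_map: "continuous_map (mahavier_space X F) (mahavier_space X F) shift_map"
proof -
  have "continuous_map (seq_space X) (seq_space X) shift_map"
    unfolding seq_space_def shift_map_def continuous_map_componentwise_UNIV
    by (auto intro!: continuous_map_product_projection)
  moreover have "shift_map x \<in> mahavier_product X F" if "x \<in> mahavier_product X F" for x
    using that by (auto simp: mahavier_product_def shift_map_def topspace_seq_space)
  ultimately show ?thesis
    unfolding mahavier_space_def
    by (auto simp: continuous_map_in_subtopology continuous_map_from_subtopology mahavier_product_def)
qed

text \<open>A list keeps the box together with its representation: its length serves as
  \<open>m j\<close> and its entries as the sides. Lists over a countable base form a countable
  set.\<close>

definition cylinder :: "'a set \<Rightarrow> 'a set list \<Rightarrow> (nat \<Rightarrow> 'a) set" where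
  "cylinder X l = (\<Pi>\<^sub>E i\<in>UNIV. if i < length l then l ! i else X)"

lemma openin_cylinder:
  assumes "\<forall>S \<in> set l. openin (top_of_set X) S"
  shows "openin (seq_space X) (cylinder X l)"
proof -
  have "finite {i. (if i < length l then l ! i else X) \<noteq> X}"
    by (rule finite_subset[of _ "{..<length l}"]) auto
  then show ?thesis
    unfolding seq_space_def cylinder_def using assms
    by (intro product_topology_basis) auto
qed

lemma cylinder_basis:
  assumes B: "\<And>U x. openin (top_of_set X) U \<Longrightarrow> x \<in> U \<Longrightarrow> \<exists>S\<in>\<B>. x \<in> S \<and> S \<subseteq> U"
    and V: "openin (seq_space X) V" and t: "t \<in> V"
  shows "\<exists>l \<in> lists \<B>. l \<noteq> [] \<and> t \<in> cylinder X l \<and> cylinder X l \<subseteq> V"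
proof -
  obtain W where W: "finite {i. W i \<noteq> X}" "\<And>i. openin (top_of_set X) (W i)"
      "t \<in> Pi\<^sub>E UNIV W" "Pi\<^sub>E UNIV W \<subseteq> V"
    using V t unfolding seq_space_def openin_product_topology_alt by auto
  obtain N where N: "\<And>i. W i \<noteq> X \<Longrightarrow> i < N"
    using W(1) unfolding finite_nat_set_iff_bounded by blast
  have "\<forall>i. \<exists>S. S \<in> \<B> \<and> t i \<in> S \<and> S \<subseteq> W i"
    using B[OF W(2) PiE_mem[OF W(3) UNIV_I]] by blast
  from choice[OF this] obtain S where S: "\<And>i. S i \<in> \<B> \<and> t i \<in> S i \<and> S i \<subseteq> W i"
    by blast
  \<comment> \<open>Length \<open>Suc N\<close> instead of \<open>N\<close> keeps the list non-empty
    even when no coordinate is restricted. From index \<open>N\<close> on, \<open>W i\<close> is all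
    of \<open>X\<close>, so leaving the later coordinates free is harmless.\<close>
  let ?l = "map S [0..<Suc N]"
  have tX: "t i \<in> X" for i
    using V t openin_subset by (force simp: topspace_seq_space)
  have eq: "(if i < length ?l then ?l ! i else X) = (if i < Suc N then S i else X)" for i
    by (simp del: upt_Suc)
  have "t \<in> cylinder X ?l"
    unfolding cylinder_def eq using S tX by auto
  moreover have "cylinder X ?l \<subseteq> Pi\<^sub>E UNIV W"
    unfolding cylinder_def eq
  proof (rule PiE_mono)
    show "(if i < Suc N then S i else X) \<subseteq> W i" for i
      using S N[of i] by (cases "i < Suc N") auto
  qed
  moreover have "?l \<in> lists \<B>" "?l \<noteq> []" using S by auto
  ultimately show ?thesis using W(4) by blast
qed

theorem theorem5p11:
  fixes X :: "'a::metric_space set" and F :: "('a \<times> 'a) set"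
  assumes "CR_dynamical_system X F"
    and "mahavier_product X F \<noteq> {}"
    and "transitive_system (mahavier_space X F) shift_map"
  shows "sigma_transitive X F"
proof -
  let ?M = "mahavier_product X F"
  have "second_countable (top_of_set X)"
    using assms(1) second_countable_compact_metric unfolding CR_dynamical_system_def by blast
  then obtain \<B> where B: "countable \<B>" "\<And>S. S \<in> \<B> \<Longrightarrow> openin (top_of_set X) S"
      "\<And>U x. openin (top_of_set X) U \<Longrightarrow> x \<in> U \<Longrightarrow> \<exists>S\<in>\<B>. x \<in> S \<and> S \<subseteq> U"
    unfolding second_countable_def by metis
  \<comment> \<open>Cylinders missing \<open>?M\<close> must go, since every \<open>U j\<close> has
    to contain a point of the orbit. The base condition survives because it concerns only points of
    \<open>?M\<close>.\<close>
  define \<L> where "\<L> = {l \<in> lists \<B>. l \<noteq> [] \<and> cylinder X l \<inter> ?M \<noteq> {}}"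
  have basis: "\<exists>l \<in> \<L>. t \<in> cylinder X l \<and> cylinder X l \<subseteq> V" if "openin (seq_space X) V" "t \<in> V \<inter> ?M" for V t
  proof -
    have "\<exists>l \<in> lists \<B>. l \<noteq> [] \<and> t \<in> cylinder X l \<and> cylinder X l \<subseteq> V"
      using that by (intro cylinder_basis B(3)) auto
    then show ?thesis
      using that(2) unfolding \<L>_def by blast
  qed
  \<comment> \<open>Non-emptiness lets \<open>from_nat_into\<close> have range exactly
    \<open>\<L>\<close>.\<close>
  have ne: "\<L> \<noteq> {}"
    using basis[of "topspace (seq_space X)"] assms(2) by (auto simp: mahavier_product_def)
  have "countable \<L>"
    unfolding \<L>_def using B(1) by simp
  define L where "L = from_nat_into \<L>"
  have L: "range L = \<L>"
    unfolding L_def using ne \<open>countable \<L>\<close> by (rule range_from_nat_into)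
  define U where "U j = cylinder X (L j)" for j
  have Lj: "L j \<in> lists \<B>" "L j \<noteq> []" "U j \<inter> ?M \<noteq> {}" for j
    using L unfolding \<L>_def U_def by blast+
  have Lo: "openin (top_of_set X) (L j ! i)" if "i < length (L j)" for i j
    using Lj(1)[of j] B(2) nth_mem[OF that] unfolding in_lists_conv_set by blast
  have Uo: "openin (seq_space X) (U j)" for j
    unfolding U_def using Lj(1)[of j] B(2) by (intro openin_cylinder) auto
  have UM: "openin (mahavier_space X F) (U j \<inter> ?M) \<and> U j \<inter> ?M \<noteq> {}" for j
    using Uo Lj(3) by (auto simp: mahavier_space_def openin_subtopology)
  have "\<exists>z \<in> topspace (mahavier_space X F). \<forall>j N. \<exists>n \<ge> N. (shift_map ^^ n) z \<in> U j \<inter> ?M"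
  proof (rule transitive_system_recurrent_point)
    show "topspace (mahavier_space X F) \<noteq> {}"
      using assms(2) by (simp add: topspace_mahavier_space)
  qed (use assms UM in \<open>simp_all add: compact_space_mahavier_space Hausdorff_space_mahavier_space
      continuous_map_shift_map\<close>)
  then obtain z where z: "\<And>j N. \<exists>n\<ge>N. (shift_map ^^ n) z \<in> U j \<inter> ?M"
    by blast
  \<comment> \<open>Dependent choice: after \<open>n j\<close> is fixed, \<open>z\<close> still
    visits the next cylinder beyond \<open>n j + length (L j)\<close>.\<close>
  obtain n where n: "\<And>j. (shift_map ^^ n j) z \<in> U j \<inter> ?M" "\<And>j. n (Suc j) \<ge> n j + length (L j)"
  proof -
    have "\<exists>n. \<forall>j. (shift_map ^^ n j) z \<in> U j \<inter> ?M \<and> n (Suc j) \<ge> n j + length (L j)"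
      using z
      by (intro dependent_nat_choice[where P = "\<lambda>j k. (shift_map ^^ k) z \<in> U j \<inter> ?M"
            and Q = "\<lambda>j k k'. k' \<ge> k + length (L j)"]) blast+
    then show ?thesis using that by blast
  qed
  let ?x = "\<lambda>j. (shift_map ^^ n j) z"
  have link: "\<exists>l > length (L j). coord l (?x j) = coord 1 (?x (Suc j))" for j
  proof (intro exI conjI)
    \<comment> \<open>Both coordinates to be compared are \<open>z (n (Suc j))\<close>. Since
      \<open>coord\<close> counts from 1, the index is the gap plus one, which turns a gap of at
      least \<open>length (L j)\<close> into the strict inequality.\<close>
    show "Suc (n (Suc j) - n j) > length (L j)"
      using n(2)[of j] by simp
    show "coord (Suc (n (Suc j) - n j)) (?x j) = coord 1 (?x (Suc j))"
      using n(2)[of j] by (simp add: coord_def shift_map_funpow)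
  qed
  show ?thesis
    unfolding sigma_transitive_def
  proof (rule exI[of _ U], rule exI[of _ "\<lambda>j. length (L j)"], rule exI[of _ "\<lambda>j i. L j ! i"], intro conjI)
    show "\<forall>j. 0 < length (L j) \<and> (\<forall>i<length (L j). openin (top_of_set X) (L j ! i)) \<and>
        U j = (\<Pi>\<^sub>E i\<in>UNIV. if i < length (L j) then L j ! i else X)"
      using Lj(1,2) Lo by (auto simp: U_def cylinder_def)
    show "\<forall>V. openin (seq_space X) V \<and> V \<inter> ?M \<noteq> {} \<longrightarrow> (\<forall>t\<in>V \<inter> ?M. \<exists>j. t \<in> U j \<and> U j \<subseteq> V)"
      using basis unfolding U_def L[symmetric] by (metis rangeE)
    show "\<exists>x. (\<forall>j. x j \<in> ?M) \<and> (\<forall>j. x j \<in> U j \<and> (\<exists>l > length (L j). coord l (x j) = coord 1 (x (Suc j))))"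
      using n(1) link by (intro exI[of _ ?x]) auto
  qed (use Uo in blast)
qed

end
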